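(* Let $h\ge 4$ be an integer. The knight's shoelace pattern in a $7\times h$ rectangle (7 columns, $h$ rows) takes exactly $2h-3$ days; that is, the sequence of cells visited by the shoelace pattern, including the starting cell, has exactly $2h-3$ terms.
   Context: Cells of the rectangle are $(x,y)$ with $1\le x\le 7$ (column) and $1\le y\le h$ (row). A knight moves from $(x,y)$ to $(x',y')$ when $\{|x-x'|,|y-y'|\}=\{1,2\}$. The number of days a route takes is the number of cells visited, including the starting cell. The shoelace pattern is the following knight's route. Start at $(3,2)$ and zig-zag upward between columns 3 and 5, going up one row at each move: $(3,2),(5,3),(3,4),(5,5),\dots$, until row $h-1$ is reached, in a cell $(c,h-1)$ with $c\in\{3,5\}$. Then move to the transition cell $(4,h-3)$, and from there to the cell of row $h-1$ in the opposite column, $(8-c,h-1)$. Then zig-zag downward between columns 3 and 5, going down one row at each move, until the cell $(5,2)$ is reached, where the pattern ends. (On the way down, the knight visits $(8-c',y)$ exactly when it visited $(c',y)$ on the way up.) *)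

theory Defs
  imports Main
begin

type_synonym cell = "int \<times> int"

definition in_rectangle :: "int \<Rightarrow> cell \<Rightarrow> bool" where
  "in_rectangle h = (\<lambda>(x, y). 1 \<le> x \<and> x \<le> 7 \<and> 1 \<le> y \<and> y \<le> h)"

definition knight_move :: "cell \<Rightarrow> cell \<Rightarrow> bool" where
  "knight_move = (\<lambda>(x, y) (x', y'). {\<bar>x - x'\<bar>, \<bar>y - y'\<bar>} = {1, 2})"

definition knight_route :: "int \<Rightarrow> cell list \<Rightarrow> bool" where
  "knight_route h p \<longleftrightarrow>
     p \<noteq> [] \<and> (\<forall>a \<in> set p. in_rectangle h a) \<and> successively knight_move p"

definition days :: "cell list \<Rightarrow> nat" where
  "days p = length p"

(* The row changes by d at each move, where d = 1 upward and d = -1 downward.  As the rows are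
   strictly monotone along p, the final cell b is also the first visit to its row. *)
definition zigzag :: "int \<Rightarrow> cell \<Rightarrow> cell \<Rightarrow> cell list \<Rightarrow> bool" where
  "zigzag d a b p \<longleftrightarrow>
     p \<noteq> [] \<and> hd p = a \<and> last p = b \<and>
     successively (\<lambda>(x, y) (x', y'). {x, x'} = {3, 5} \<and> y' = y + d) p"

definition shoelace_pattern :: "int \<Rightarrow> cell list \<Rightarrow> bool" where
  "shoelace_pattern h p \<longleftrightarrow>
     knight_route h p \<and>
     (\<exists>c up down.
        c \<in> {3, 5} \<and>
        zigzag 1 (3, 2) (c, h - 1) up \<and>
        zigzag (-1) (8 - c, h - 1) (5, 2) down \<and>
        p = up @ [(4, h - 3)] @ down)"

end

theory Submission
  imports Defs
begin

text \<open>
  A zig-zag leaves no choice: its first cell and its vertical direction determine every later cell,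
  since the columns 3 and 5 alternate and the row changes by one at each move.  A zig-zag is therefore
  determined by its start and its number of moves (\<open>successively_iff_zigzag_cells\<close>), and the row
  of its final cell fixes the number of moves.

  Both halves of the shoelace join the rows 2 and \<open>h - 1\<close>, so each makes \<open>h - 3\<close> moves and visits
  \<open>h - 2\<close> cells; with the transition cell this gives \<open>2 * (h - 2) + 1 = 2 * h - 3\<close>.  The parity of
  \<open>h - 3\<close> determines the column in which the upward half ends.  Starting in the opposite column, the
  downward half is the mirror image of the upward half, which is why it ends in \<open>(5, 2)\<close>, opposite
  to the start \<open>(3, 2)\<close>.
\<close>

primrec zigzag_cells :: "int \<Rightarrow> int \<Rightarrow> int \<Rightarrow> nat \<Rightarrow> cell list" where
  "zigzag_cells d x y 0 = [(x, y)]"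
| "zigzag_cells d x y (Suc n) = (x, y) # zigzag_cells d (8 - x) (y + d) n"

lemma zigzag_cells_neq_Nil [simp]: "zigzag_cells d x y n \<noteq> []"
  by (cases n) auto

lemma hd_zigzag_cells [simp]: "hd (zigzag_cells d x y n) = (x, y)"
  by (cases n) auto

lemma last_zigzag_cells [simp]:
  "last (zigzag_cells d x y n) = (if even n then x else 8 - x, y + d * int n)"
  by (induction n arbitrary: x y) (auto simp: algebra_simps)

lemma length_zigzag_cells [simp]: "length (zigzag_cells d x y n) = Suc n"
  by (induction n arbitrary: x y) auto

lemma set_zigzag_cells_subset:
  assumes "x \<in> {3, 5}"
  shows "set (zigzag_cells d x y n) \<subseteq> {3, 5} \<times> (\<lambda>k. y + d * int k) ` {..n}"
  using assms
proof (induction n arbitrary: x y)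
  case (Suc n)
  have "(\<lambda>k. y + d + d * int k) ` {..n} \<subseteq> (\<lambda>k. y + d * int k) ` {..Suc n}"
  proof
    fix z assume "z \<in> (\<lambda>k. y + d + d * int k) ` {..n}"
    then obtain k where "k \<le> n" "z = y + d * int (Suc k)"
      by (auto simp: algebra_simps)
    then show "z \<in> (\<lambda>k. y + d * int k) ` {..Suc n}"
      by (intro image_eqI[of _ _ "Suc k"]) auto
  qed
  moreover have "set (zigzag_cells d (8 - x) (y + d) n)
      \<subseteq> {3, 5} \<times> (\<lambda>k. y + d + d * int k) ` {..n}"
    using Suc.prems by (intro Suc.IH) auto
  moreover have "y \<in> (\<lambda>k. y + d * int k) ` {..Suc n}"
    by (rule image_eqI[of _ _ 0]) auto
  ultimately show ?case
    using Suc.prems by (simp only: zigzag_cells.simps list.set) blast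
qed auto

lemma successively_knight_move_zigzag_cells:
  assumes "x \<in> {3, 5}" "\<bar>d\<bar> = 1"
  shows "successively knight_move (zigzag_cells d x y n)"
  using assms(1)
proof (induction n arbitrary: x y)
  case (Suc n)
  have "successively knight_move (zigzag_cells d (8 - x) (y + d) n)"
    using Suc.prems by (intro Suc.IH) auto
  moreover have "knight_move (x, y) (8 - x, y + d)"
    using Suc.prems assms(2) by (auto simp: knight_move_def)
  ultimately show ?case
    by (simp add: successively_Cons)
qed simp

text \<open>
  The condition on one move determines the next cell: in \<open>{3, 5}\<close> the partner of \<open>x\<close> is \<open>8 - x\<close>.
\<close>

lemma successively_iff_zigzag_cells:
  assumes "x \<in> {3, 5}"
  shows "p \<noteq> [] \<and> hd p = (x, y) \<and>
      successively (\<lambda>(x, y) (x', y'). {x, x'} = {3, 5} \<and> y' = y + d) p \<longleftrightarrow>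
    (\<exists>n. p = zigzag_cells d x y n)"
    (is "_ \<and> _ \<and> successively ?R p \<longleftrightarrow> _")
proof (intro iffI; (elim exE conjE)?)
  assume "p \<noteq> []" "hd p = (x, y)" "successively ?R p"
  then show "\<exists>n. p = zigzag_cells d x y n"
    using assms
  proof (induction p arbitrary: x y)
    case (Cons a q)
    show ?case
    proof (cases "q = []")
      case True
      then have "a # q = zigzag_cells d x y 0"
        using Cons.prems by simp
      then show ?thesis ..
    next
      case False
      have "?R a (hd q)" and q: "successively ?R q"
        using Cons.prems False by (auto simp: successively_Cons)
      then have "hd q = (8 - x, y + d)"
        using Cons.prems by (cases "hd q") (auto simp: doubleton_eq_iff)
      moreover have "8 - x \<in> {3, 5}"
        using Cons.prems by auto
      ultimately obtain n where "q = zigzag_cells d (8 - x) (y + d) n"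
        using Cons.IH[OF False _ q] by blast
      then have "a # q = zigzag_cells d x y (Suc n)"
        using Cons.prems by simp
      then show ?thesis ..
    qed
  qed simp
next
  fix n assume p: "p = zigzag_cells d x y n"
  have "successively ?R (zigzag_cells d x y n)"
    using assms
  proof (induction n arbitrary: x y)
    case (Suc n)
    have "successively ?R (zigzag_cells d (8 - x) (y + d) n)"
      using Suc.prems by (intro Suc.IH) auto
    moreover have "{x, 8 - x} = {3, 5}"
      using Suc.prems by auto
    ultimately show ?case
      by (simp add: successively_Cons)
  qed simp
  then show "p \<noteq> [] \<and> hd p = (x, y) \<and> successively ?R p"
    using p by simp
qed

lemma zigzag_iff_zigzag_cells:
  assumes "x \<in> {3, 5}"
  shows "zigzag d (x, y) (x', y') p \<longleftrightarrow>
    (\<exists>n. p = zigzag_cells d x y n \<and> x' = (if even n then x else 8 - x) \<and> y' = y + d * int n)"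
proof -
  have "zigzag d (x, y) (x', y') p \<longleftrightarrow> last p = (x', y') \<and> (\<exists>n. p = zigzag_cells d x y n)"
    unfolding successively_iff_zigzag_cells[OF assms, symmetric] zigzag_def by blast
  then show ?thesis
    by auto
qed

text \<open>
  The parameter is the number of moves of each half, so the rectangle has height \<open>n + 3\<close>.
\<close>

definition shoelace :: "nat \<Rightarrow> cell list" where
  "shoelace n = (let c = (if even n then 3 else 5) in
     zigzag_cells 1 3 2 n @ [(4, int n)] @ zigzag_cells (- 1) (8 - c) (int n + 2) n)"

text \<open>
  Inside a half every step is a knight's move, two columns and one row.  At the turn the transition
  cell \<open>(4, n)\<close> lies one column and two rows from each of the cells \<open>(3, n + 2)\<close> and \<open>(5, n + 2)\<close>,
  so the turn is possible whichever of them ends the upward half.  The row of the transition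
  cell is at least 1 exactly when \<open>n\<close> is.
\<close>

lemma knight_route_shoelace:
  assumes "n \<ge> 1"
  shows "knight_route (int n + 3) (shoelace n)"
proof -
  define c :: int where "c = (if even n then 3 else 5)"
  have c: "c \<in> {3, 5}" "8 - c \<in> {3, 5}"
    by (auto simp: c_def)
  have eq: "shoelace n =
      zigzag_cells 1 3 2 n @ [(4, int n)] @ zigzag_cells (- 1) (8 - c) (int n + 2) n"
    by (simp add: shoelace_def c_def Let_def)
  have "in_rectangle (int n + 3) a" if "a \<in> set (zigzag_cells 1 3 2 n)" for a
    using that set_zigzag_cells_subset[of 3 1 2 n] by (fastforce simp: in_rectangle_def)
  moreover have "in_rectangle (int n + 3) a"
    if "a \<in> set (zigzag_cells (- 1) (8 - c) (int n + 2) n)" for a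
    using that set_zigzag_cells_subset[OF c(2), of "- 1" "int n + 2" n]
    by (fastforce simp: in_rectangle_def)
  moreover have "in_rectangle (int n + 3) (4, int n)"
    using assms by (simp add: in_rectangle_def)
  moreover have "knight_move (last (zigzag_cells 1 3 2 n)) (4, int n)"
    by (auto simp: knight_move_def)
  moreover have "knight_move (4, int n) (8 - c, int n + 2)"
    by (auto simp: knight_move_def c_def)
  ultimately show ?thesis
    using successively_knight_move_zigzag_cells[of 3 1 2 n]
      successively_knight_move_zigzag_cells[OF c(2), of "- 1" "int n + 2" n]
    unfolding knight_route_def eq
    by (auto simp: successively_append_iff successively_Cons simp del: last_zigzag_cells)
qed

lemma shoelace_pattern_iff:
  assumes "n \<ge> 1"
  shows "shoelace_pattern (int n + 3) p \<longleftrightarrow> p = shoelace n"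
proof -
  have rows: "int n + 3 - 1 = int n + 2" "int n + 3 - 3 = int n"
    by simp_all
  show ?thesis
  proof
    assume "shoelace_pattern (int n + 3) p"
    then obtain c up down where c: "c \<in> {3, 5}"
      and up: "zigzag 1 (3, 2) (c, int n + 2) up"
      and down: "zigzag (- 1) (8 - c, int n + 2) (5, 2) down"
      and p: "p = up @ [(4, int n)] @ down"
      unfolding shoelace_pattern_def rows by blast
    from up have "up = zigzag_cells 1 3 2 n" "c = (if even n then 3 else 5)"
      by (auto simp: zigzag_iff_zigzag_cells)
    moreover have "down = zigzag_cells (- 1) (8 - c) (int n + 2) n"
    proof -
      have "8 - c \<in> {3, 5}"
        using c by auto
      with down show ?thesis
        by (auto simp: zigzag_iff_zigzag_cells)
    qed
    ultimately show "p = shoelace n"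
      by (simp add: p shoelace_def)
  next
    assume p: "p = shoelace n"
    define c :: int where "c = (if even n then 3 else 5)"
    have "zigzag 1 (3, 2) (c, int n + 2) (zigzag_cells 1 3 2 n)"
      by (auto simp: zigzag_iff_zigzag_cells c_def)
    moreover have "8 - c \<in> {3, 5}"
      by (simp add: c_def)
    then have "zigzag (- 1) (8 - c, int n + 2) (5, 2) (zigzag_cells (- 1) (8 - c) (int n + 2) n)"
      by (subst zigzag_iff_zigzag_cells) (auto simp: c_def)
    moreover have "c \<in> {3, 5}"
      by (simp add: c_def)
    moreover have "p = zigzag_cells 1 3 2 n @ [(4, int n)] @
        zigzag_cells (- 1) (8 - c) (int n + 2) n"
      by (simp add: p shoelace_def c_def Let_def)
    ultimately show "shoelace_pattern (int n + 3) p"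
      using knight_route_shoelace[OF assms] p unfolding shoelace_pattern_def rows by metis
  qed
qed

lemma days_shoelace: "days (shoelace n) = 2 * n + 3"
  by (simp add: days_def shoelace_def Let_def)

theorem theorem1:
  fixes h :: int
  assumes "h \<ge> 4"
  shows "(\<exists>!p. shoelace_pattern h p) \<and>
         (\<forall>p. shoelace_pattern h p \<longrightarrow> int (days p) = 2 * h - 3)"
proof -
  define n where "n = nat (h - 3)"
  have h: "h = int n + 3" and "n \<ge> 1"
    using assms by (auto simp: n_def)
  then show ?thesis
    by (simp add: shoelace_pattern_iff days_shoelace)
qed

end
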